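(* Let $P$ be the probability distribution on $\{0,1\}^4$ with the following non-zero probabilities: $P(1,1,0,0)=\tfrac12$, $P(0,0,1,0)=\tfrac7{16}$, $P(0,0,0,1)=\tfrac1{16}$, and let $Y=(Y_1,Y_2,Y_3,Y_4)\sim P$. Then $$\mathbb{E}_P[Y]=\left(\tfrac12,\tfrac12,\tfrac7{16},\tfrac1{16}\right)\quad\text{and}\quad \mathbb{E}_P[\alpha(Y)]=\left(\tfrac18,\tfrac18,\tfrac7{48},\tfrac1{48}\right).$$ Let $\precsim_P$ and $\precsim_\alpha$ be the total preorders induced by $\mathbb{E}_P[Y]$ and $\mathbb{E}_P[\alpha(Y)]$, respectively. Then $\rho(\precsim_P)=(2,2,-1,-3)$ and $\rho(\precsim_\alpha)=(0,0,3,-3)$, and the expected AUCs satisfy $$\mathbb{E}_P[\mathrm{AUC}(Y,\precsim_P)]=\tfrac{31}{48}<\mathbb{E}_P[\mathrm{AUC}(Y,\precsim_\alpha)]=\tfrac{33}{48}.$$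
   Context: Here $n=4$. A total preorder on $\{1,\dots,n\}$ is a transitive, reflexive relation $\precsim$ such that for any $i,j$ at least one of $i\precsim j$ or $j\precsim i$ holds; $i\succsim j$ means $j\precsim i$. A vector $v\in\mathbb{R}^n$ induces the total preorder $\precsim_v$ given by $i\precsim_v j\Leftrightarrow v_i\le v_j$. The rank vector $\rho(\precsim)=(\rho_1(\precsim),\dots,\rho_n(\precsim))$ of a total preorder is $\rho_i(\precsim)=\sum_{j=1}^n\left(\mathbf 1_{j\precsim i}-\mathbf 1_{j\succsim i}\right)$. For $y\in\{0,1\}^n$ let $n_1(y)=\sum_{i=1}^n y_i$ and $n_0(y)=n-n_1(y)$, and let $\alpha_i(y)=\dfrac{y_i}{n_0(y)n_1(y)}$ if $n_1(y)\notin\{0,n\}$ and $\alpha_i(y)=0$ otherwise; $\alpha=(\alpha_1,\dots,\alpha_n)$. The empirical area under the (receiver operating characteristic) curve is $$\mathrm{AUC}(y,\precsim)=\tfrac12+\tfrac12\sum_{i=1}^n\alpha_i(y)\rho_i(\precsim).$$ *)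

theory Defs
  imports "HOL-Probability.Probability"
begin

text \<open>The index set \<open>{1,...,n}\<close> is a finite type \<open>'n\<close>; for \<open>n = 4\<close> it is the numeral
  type \<open>4\<close>, whose elements are \<open>1, 2, 3, 4\<close>, and \<open>vector [a, b, c, d]\<close> has the components
  \<open>a, b, c, d\<close> at these indices (lemma \<open>vector_4\<close> below). A relation \<open>\<precsim>\<close> is represented by
  the set of pairs \<open>(i, j)\<close> with \<open>i \<precsim> j\<close>.\<close>

definition total_preorder :: "'n rel \<Rightarrow> bool" where
  "total_preorder r \<longleftrightarrow> preorder_on UNIV r \<and> (\<forall>i j. (i, j) \<in> r \<or> (j, i) \<in> r)"

definition induced_preorder :: "real ^ 'n \<Rightarrow> 'n rel" where
  "induced_preorder v = {(i, j). v $ i \<le> v $ j}"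

lemma total_preorder_induced_preorder: "total_preorder (induced_preorder v)"
  by (auto simp: total_preorder_def induced_preorder_def preorder_on_def refl_on_def trans_def)

definition rank_vector :: "'n::finite rel \<Rightarrow> real ^ 'n" where
  "rank_vector r = (\<chi> i. \<Sum>j\<in>UNIV. of_bool ((j, i) \<in> r) - of_bool ((i, j) \<in> r))"

text \<open>Label vectors are real vectors with entries in \<open>{0, 1}\<close>, so that their expectations
  are vectors of the same type. The functions below are only meaningful on such vectors.\<close>

definition binary_vectors :: "(real ^ 'n) set" where
  "binary_vectors = {y. \<forall>i. y $ i \<in> {0, 1}}"

definition n1 :: "real ^ 'n::finite \<Rightarrow> real" where
  "n1 y = (\<Sum>i\<in>UNIV. y $ i)"

definition n0 :: "real ^ 'n::finite \<Rightarrow> real" where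
  "n0 y = real CARD('n) - n1 y"

definition alpha :: "real ^ 'n::finite \<Rightarrow> real ^ 'n" where
  "alpha y = (\<chi> i. if n1 y \<notin> {0, real CARD('n)} then y $ i / (n0 y * n1 y) else 0)"

definition AUC :: "real ^ 'n::finite \<Rightarrow> 'n rel \<Rightarrow> real" where
  "AUC y r = 1/2 + 1/2 * (\<Sum>i\<in>UNIV. alpha y $ i * rank_vector r $ i)"

lemma vector_4:
  "(vector [a, b, c, d] :: 'a::zero ^ 4) $ 1 = a"
  "(vector [a, b, c, d] :: 'a::zero ^ 4) $ 2 = b"
  "(vector [a, b, c, d] :: 'a::zero ^ 4) $ 3 = c"
  "(vector [a, b, c, d] :: 'a::zero ^ 4) $ 4 = d"
  by (simp_all add: vector_def)

text \<open>A distribution with the support and the weights of the example exists.\<close>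

lemma example_distribution_exists:
  "\<exists>P :: (real ^ 4) pmf. set_pmf P \<subseteq> binary_vectors
    \<and> pmf P (vector [1, 1, 0, 0]) = 1/2
    \<and> pmf P (vector [0, 0, 1, 0]) = 7/16
    \<and> pmf P (vector [0, 0, 0, 1]) = 1/16"
proof -
  define xs :: "((real ^ 4) \<times> real) list" where
    "xs = [(vector [1, 1, 0, 0], 1/2), (vector [0, 0, 1, 0], 7/16), (vector [0, 0, 0, 1], 1/16)]"
  have wf: "pmf_of_list_wf xs"
    by (auto simp: pmf_of_list_wf_def xs_def)
  have "set_pmf (pmf_of_list xs) \<subseteq> binary_vectors"
    using set_pmf_of_list[OF wf]
    by (auto simp: xs_def binary_vectors_def forall_4 vector_4)
  then show ?thesis
    by (intro exI[of _ "pmf_of_list xs"])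
      (simp add: pmf_pmf_of_list[OF wf], simp add: xs_def vec_eq_iff forall_4 vector_4)
qed

end

theory Submission
  imports Defs
begin

text \<open>The three given weights sum to 1, so \<open>P\<close> is supported on three points and
  every expectation is a weighted sum of three values. The normalisation in \<open>alpha\<close>
  divides by 2*2 = 4 for the label vector with two ones, but only by 1*3 = 3 for those with a single
  one. This lifts index 3 from below indices 1 and 2 (7/16 < 1/2) to above them (7/48 > 6/48). Since
  the AUC is affine in \<open>alpha\<close>, ranking by the mean of \<open>alpha\<close> is what
  pays off.\<close>

text \<open>Mass 1 on \<open>A\<close> means that almost every point lies in \<open>A\<close>, and
  for a pmf this covers each point of the support.\<close>

lemma set_pmf_subset_finite:
  assumes "finite A" "(\<Sum>x\<in>A. pmf p x) = 1"
  shows "set_pmf p \<subseteq> A"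
proof -
  have "measure_pmf.prob p A = 1"
    using assms by (simp add: measure_measure_pmf_finite)
  then show ?thesis
    by (auto simp: measure_pmf.prob_eq_1 AE_measure_pmf_iff)
qed

theorem mainTheorem2:
  fixes P :: "(real ^ 4) pmf"
  assumes "set_pmf P \<subseteq> binary_vectors"
    and "pmf P (vector [1, 1, 0, 0]) = 1/2"
    and "pmf P (vector [0, 0, 1, 0]) = 7/16"
    and "pmf P (vector [0, 0, 0, 1]) = 1/16"
  shows "measure_pmf.expectation P (\<lambda>Y. Y) = vector [1/2, 1/2, 7/16, 1/16]
    \<and> measure_pmf.expectation P (\<lambda>Y. alpha Y) = vector [1/8, 1/8, 7/48, 1/48]
    \<and> (let prec_P = induced_preorder (measure_pmf.expectation P (\<lambda>Y. Y));
           prec_alpha = induced_preorder (measure_pmf.expectation P (\<lambda>Y. alpha Y))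
       in rank_vector prec_P = vector [2, 2, -1, -3]
        \<and> rank_vector prec_alpha = vector [0, 0, 3, -3]
        \<and> measure_pmf.expectation P (\<lambda>Y. AUC Y prec_P) = 31/48
        \<and> measure_pmf.expectation P (\<lambda>Y. AUC Y prec_alpha) = 33/48
        \<and> measure_pmf.expectation P (\<lambda>Y. AUC Y prec_P)
            < measure_pmf.expectation P (\<lambda>Y. AUC Y prec_alpha))"
proof -
  define a b c :: "real ^ 4"
    where "a = vector [1, 1, 0, 0]" and "b = vector [0, 0, 1, 0]" and "c = vector [0, 0, 0, 1]"
  note abc = a_def b_def c_def
  \<comment> \<open>Distinctness lets sums over the set \<open>{a, b, c}\<close> split into three
    terms.\<close>
  have distinct: "a \<noteq> b" "a \<noteq> c" "b \<noteq> c"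
    by (auto simp: abc vec_eq_iff forall_4 vector_4)
  have weights: "pmf P a = 1/2" "pmf P b = 7/16" "pmf P c = 1/16"
    using assms by (simp_all add: abc)
  have "set_pmf P \<subseteq> {a, b, c}"
    by (rule set_pmf_subset_finite) (use distinct weights in auto)
  \<comment> \<open>Kept polymorphic in \<open>'b\<close>: it serves both the vector-valued means
    and the real-valued AUCs.\<close>
  then have "measure_pmf.expectation P f = (\<Sum>y\<in>{a, b, c}. pmf P y *\<^sub>R f y)"
    for f :: "real ^ 4 \<Rightarrow> 'b::{banach, second_countable_topology}"
    by (intro integral_measure_pmf) auto
  then have expectation:
    "measure_pmf.expectation P f = (1/2) *\<^sub>R f a + (7/16) *\<^sub>R f b + (1/16) *\<^sub>R f c"
    for f :: "real ^ 4 \<Rightarrow> 'b::{banach, second_countable_topology}"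
    using distinct weights by (simp add: add.assoc)
  have mean: "measure_pmf.expectation P (\<lambda>Y. Y) = vector [1/2, 1/2, 7/16, 1/16]"
    by (simp add: expectation[of "\<lambda>Y. Y"] abc vec_eq_iff forall_4 vector_4)
  have alpha:
    "alpha a = vector [1/4, 1/4, 0, 0]"
    "alpha b = vector [0, 0, 1/3, 0]"
    "alpha c = vector [0, 0, 0, 1/3]"
    by (simp_all add: abc alpha_def n0_def n1_def vec_eq_iff forall_4 sum_4 vector_4)
  have mean_alpha:
    "measure_pmf.expectation P (\<lambda>Y. alpha Y) = vector [1/8, 1/8, 7/48, 1/48]"
    by (simp add: expectation[of alpha] alpha vec_eq_iff forall_4 vector_4)
  define prec_P where "prec_P = induced_preorder (measure_pmf.expectation P (\<lambda>Y. Y))"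
  define prec_alpha where "prec_alpha = induced_preorder (measure_pmf.expectation P (\<lambda>Y. alpha Y))"
  \<comment> \<open>Indices 1 and 2 tie, so they contribute 0 to each other's rank.\<close>
  have rank_P: "rank_vector prec_P = vector [2, 2, -1, -3]"
    by (simp add: prec_P_def mean rank_vector_def induced_preorder_def
        vec_eq_iff forall_4 sum_4 vector_4)
  have rank_alpha: "rank_vector prec_alpha = vector [0, 0, 3, -3]"
    by (simp add: prec_alpha_def mean_alpha rank_vector_def induced_preorder_def
        vec_eq_iff forall_4 sum_4 vector_4)
  \<comment> \<open>In terms of the mean of \<open>alpha\<close>, this is 1/2 + 1/2 * (24 - 7 -
    3)/48; the other ranking gives 1/2 + 1/2 * (21 - 3)/48.\<close>
  have AUC_P: "measure_pmf.expectation P (\<lambda>Y. AUC Y prec_P) = 31/48"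
    unfolding expectation by (simp add: AUC_def alpha rank_P sum_4 vector_4)
  have AUC_alpha: "measure_pmf.expectation P (\<lambda>Y. AUC Y prec_alpha) = 33/48"
    unfolding expectation by (simp add: AUC_def alpha rank_alpha sum_4 vector_4)
  show ?thesis
    unfolding Let_def prec_P_def[symmetric] prec_alpha_def[symmetric]
    using mean mean_alpha rank_P rank_alpha AUC_P AUC_alpha by simp
qed

end
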